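(* Let $k$ be an algebraically closed field and let $A \subset M_6(k)$ be a maximal commutative subalgebra. Then $\dim_k A \geq 6$.
   Context: $M_n(k)$ denotes the algebra of $n\times n$ matrices over $k$. A commutative subalgebra $A \subset M_n(k)$ is called maximal if it coincides with its centralizer in $M_n(k)$. *)

theory Defs
  imports "HOL-Analysis.Analysis" "HOL-Computational_Algebra.Polynomial"
begin

text \<open>The distribution makes column vectors over an arbitrary field a vector space (interpretation
  \<open>vec\<close>), but provides no such structure for matrices. We supply it, with entrywise scaling.\<close>

definition matrix_scale :: "'a::times \<Rightarrow> 'a ^ 'n ^ 'm \<Rightarrow> 'a ^ 'n ^ 'm" where
  "matrix_scale c M = (\<chi> i j. c * M $ i $ j)"

definition matrix_unit :: "'m \<Rightarrow> 'n \<Rightarrow> 'a::zero_neq_one ^ 'n ^ 'm" where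
  "matrix_unit i j = axis i (axis j 1)"

interpretation matsp: vector_space "matrix_scale :: 'a::field \<Rightarrow> 'a ^ 'n ^ 'm \<Rightarrow> 'a ^ 'n ^ 'm"
  by unfold_locales (simp_all add: matrix_scale_def vec_eq_iff algebra_simps)

lemma sum_matrix_units_nth:
  fixes c :: "'m::finite \<times> 'n::finite \<Rightarrow> 'a::field"
  shows "(\<Sum>p\<in>UNIV. matrix_scale (c p) (matrix_unit (fst p) (snd p))) $ i $ j = c (i, j)"
proof -
  have "(\<Sum>p\<in>UNIV. matrix_scale (c p) (matrix_unit (fst p) (snd p))) $ i $ j =
        (\<Sum>p\<in>UNIV. if p = (i, j) then c p else 0)"
    unfolding sum_component
    by (rule sum.cong) (auto simp: matrix_scale_def matrix_unit_def axis_def)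
  then show ?thesis by simp
qed

lemma inj_matrix_unit:
  "inj (\<lambda>p :: 'm::finite \<times> 'n::finite. matrix_unit (fst p) (snd p) :: 'a::field ^ 'n ^ 'm)"
  by (rule injI) (auto simp: matrix_unit_def axis_eq_axis)

interpretation matsp: finite_dimensional_vector_space
  "matrix_scale :: 'a::field \<Rightarrow> 'a ^ 'n ^ 'm \<Rightarrow> 'a ^ 'n ^ 'm"
  "range (\<lambda>p. matrix_unit (fst p) (snd p))"
proof
  let ?u = "\<lambda>p :: 'm \<times> 'n. matrix_unit (fst p) (snd p) :: 'a ^ 'n ^ 'm"
  show "finite (range ?u)" by simp
  show "matsp.independent (range ?u)"
  proof (rule matsp.independent_if_scalars_zero)
    show "finite (range ?u)" by simp
    fix f x
    assume 0: "(\<Sum>x\<in>range ?u. matrix_scale (f x) x) = 0" and "x \<in> range ?u"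
    then obtain i j where x: "x = ?u (i, j)" by auto
    have "(\<Sum>p\<in>UNIV. matrix_scale (f (?u p)) (?u p)) = 0"
      using 0 by (simp add: sum.reindex[OF inj_matrix_unit] o_def)
    then have "f (?u (i, j)) = 0"
      using sum_matrix_units_nth[of "\<lambda>p. f (?u p)" i j] by simp
    then show "f x = 0" by (simp add: x)
  qed
  show "matsp.span (range ?u) = UNIV"
  proof -
    have "M \<in> matsp.span (range ?u)" for M
    proof -
      have "(\<Sum>p\<in>UNIV. matrix_scale (M $ fst p $ snd p) (?u p)) = M"
        unfolding vec_eq_iff sum_matrix_units_nth by simp
      moreover have "(\<Sum>p\<in>UNIV. matrix_scale (M $ fst p $ snd p) (?u p)) \<in> matsp.span (range ?u)"
        by (intro matsp.span_sum matsp.span_scale matsp.span_base rangeI)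
      ultimately show ?thesis by simp
    qed
    then show ?thesis by blast
  qed
qed

definition matrix_subalgebra :: "('a::field ^ 'n ^ 'n) set \<Rightarrow> bool" where
  "matrix_subalgebra A \<longleftrightarrow>
     matsp.subspace A \<and> mat 1 \<in> A \<and> (\<forall>M\<in>A. \<forall>N\<in>A. M ** N \<in> A)"

definition commutative_matrix_subalgebra :: "('a::field ^ 'n ^ 'n) set \<Rightarrow> bool" where
  "commutative_matrix_subalgebra A \<longleftrightarrow>
     matrix_subalgebra A \<and> (\<forall>M\<in>A. \<forall>N\<in>A. M ** N = N ** M)"

definition matrix_centralizer :: "('a::field ^ 'n ^ 'n) set \<Rightarrow> ('a ^ 'n ^ 'n) set" where
  "matrix_centralizer A = {M. \<forall>N\<in>A. M ** N = N ** M}"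

definition maximal_commutative_matrix_subalgebra :: "('a::field ^ 'n ^ 'n) set \<Rightarrow> bool" where
  "maximal_commutative_matrix_subalgebra A \<longleftrightarrow>
     commutative_matrix_subalgebra A \<and> A = matrix_centralizer A"

end

theory Submission
  imports Defs
begin

text \<open>It suffices to show \<open>dim (e A) \<ge> dim W\<close>, where \<open>W = e V\<close>, for primitive idempotents \<open>e \<in> A\<close>. By
  Fitting's lemma and algebraic closedness \<open>e A = k e + N\<close> with \<open>N\<close> nil. Let \<open>r = dim (W / N W)\<close> and
  let \<open>s\<close> be the dimension of the socle \<open>S\<close> of \<open>W\<close>. If \<open>r \<le> 1\<close>, then \<open>W\<close> is cyclic by Nakayama; if
  \<open>s \<le> 1\<close>, then \<open>W\<close> is cocyclic; either way the bound holds. If \<open>r, s \<ge> 2\<close>, then by maximality \<open>N\<close>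
  contains every map that kills \<open>N W\<close> and has image in \<open>S\<close>, so \<open>dim (e A) \<ge> 1 + r s \<ge> 5\<close>. A violation
  of the bound with \<open>dim W \<le> 6\<close> therefore forces \<open>r = s = 2\<close> and \<open>N\<close> to consist of these maps
  only; but then \<open>N W \<subseteq> S\<close> and \<open>dim W \<le> 4\<close>.\<close>

text \<open>Coefficients belong to indices rather than to vectors, so a repeated vector would give a
  relation with coefficients 1 and -1. The criterion therefore also yields injectivity, which allows
  dimension counts by the size of the index set.\<close>

lemma (in vector_space) independent_family:
  assumes fin: "finite I"
    and zero: "\<And>u i. (\<Sum>i\<in>I. scale (u i) (f i)) = 0 \<Longrightarrow> i \<in> I \<Longrightarrow> u i = 0"
  shows "inj_on f I" "independent (f ` I)"
proof -
  show inj: "inj_on f I"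
  proof (rule inj_onI, rule ccontr)
    fix i j assume ij: "i \<in> I" "j \<in> I" "f i = f j" "i \<noteq> j"
    define u :: "'c \<Rightarrow> 'a" where "u = (\<lambda>k. if k = i then 1 else if k = j then -1 else 0)"
    have "(\<Sum>k\<in>I. scale (u k) (f k)) = (\<Sum>k\<in>{i, j}. scale (u k) (f k))"
      by (rule sum.mono_neutral_right) (use fin ij in \<open>auto simp: u_def\<close>)
    also have "\<dots> = 0"
      using ij by (simp add: u_def)
    finally have "u i = 0"
      using zero ij by blast
    then show False
      by (simp add: u_def)
  qed
  show "independent (f ` I)"
  proof (rule independent_if_scalars_zero)
    fix u x assume "(\<Sum>x\<in>f ` I. scale (u x) x) = 0" "x \<in> f ` I"
    then show "u x = 0"
      using zero[of "\<lambda>i. u (f i)"] by (auto simp: sum.reindex[OF inj])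
  qed (use fin in simp)
qed

section \<open>Matrices and commutative matrix algebras\<close>

lemma matrix_scale_mult_left: "matrix_scale c M ** N = matrix_scale c (M ** N)"
  for M :: "'a::field ^ 'n ^ 'm"
  by (simp add: matrix_scale_def matrix_matrix_mult_def vec_eq_iff sum_distrib_left mult_ac)

lemma matrix_scale_mult_right: "M ** matrix_scale c N = matrix_scale c (M ** N)"
  for M :: "'a::field ^ 'n ^ 'm"
  by (simp add: matrix_scale_def matrix_matrix_mult_def vec_eq_iff sum_distrib_left mult_ac)

lemma matrix_scale_vec: "matrix_scale c M *v v = c *s (M *v v)"
  for M :: "'a::field ^ 'n ^ 'm"
  by (simp add: matrix_scale_def matrix_vector_mult_def vec_eq_iff sum_distrib_left mult_ac)

lemma matrix_diff_ldistrib: "A ** (B - C) = A ** B - A ** C"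
  for A :: "'a::field ^ 'n ^ 'm"
  by (simp add: matrix_eq matrix_vector_mult_diff_rdistrib matrix_vector_mult_diff_distrib
      flip: matrix_vector_mul_assoc)

lemma matrix_diff_rdistrib: "(B - C) ** A = B ** A - C ** A"
  for A :: "'a::field ^ 'n ^ 'm"
  by (simp add: matrix_eq matrix_vector_mult_diff_rdistrib matrix_vector_mult_diff_distrib
      flip: matrix_vector_mul_assoc)

lemma sum_matrix_vec: "(\<Sum>i\<in>I. f i) *v v = (\<Sum>i\<in>I. f i *v v)"
  for f :: "'i \<Rightarrow> 'a::field ^ 'n ^ 'm"
  by (induction I rule: infinite_finite_induct) (simp_all add: matrix_vector_mult_add_rdistrib)

primrec matrix_power :: "'a::field ^ 'n ^ 'n \<Rightarrow> nat \<Rightarrow> 'a ^ 'n ^ 'n" where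
  "matrix_power M 0 = mat 1"
| "matrix_power M (Suc k) = M ** matrix_power M k"

lemma matrix_power_add: "matrix_power M (i + j) = matrix_power M i ** matrix_power M j"
  by (induction i) (simp_all add: matrix_mul_assoc)

locale commutative_matrices =
  fixes A :: "('a::field ^ 'n ^ 'n) set"
  assumes comm_algebra: "commutative_matrix_subalgebra A"
begin

lemma subspace: "matsp.subspace A"
  and one_mem: "mat 1 \<in> A"
  and mult_mem: "M \<in> A \<Longrightarrow> N \<in> A \<Longrightarrow> M ** N \<in> A"
  and commute: "M \<in> A \<Longrightarrow> N \<in> A \<Longrightarrow> M ** N = N ** M"
  using comm_algebra unfolding commutative_matrix_subalgebra_def matrix_subalgebra_def by blast+

lemmas add_mem = matsp.subspace_add[OF subspace]
  and diff_mem = matsp.subspace_diff[OF subspace]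
  and scale_mem = matsp.subspace_scale[OF subspace]
  and zero_mem = matsp.subspace_0[OF subspace]

lemma power_mem: "M \<in> A \<Longrightarrow> matrix_power M k \<in> A"
  by (induction k) (auto intro: one_mem mult_mem)

text \<open>Among the ideals b^k A with k positive choose one of least dimension. It contains b^(2k)
  A, so the two are equal, and b^k itself lies in it because \<open>mat 1\<close> is in
  \<open>A\<close>.\<close>

lemma fitting:
  assumes b: "b \<in> A"
  obtains k x where "k > 0" "x \<in> A" "matrix_power b k = matrix_power b (k + k) ** x"
proof -
  define S where "S k = (\<lambda>y. matrix_power b k ** y) ` A" for k
  have sub: "matsp.subspace (S k)" for k
    unfolding S_def
    by (rule matsp.subspaceI)
       (use zero_mem in force, auto simp: matrix_add_ldistrib[symmetric]
         matrix_scale_mult_right[symmetric] intro!: imageI add_mem scale_mem)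
  obtain k where k: "k > 0" and min: "\<And>j. j > 0 \<Longrightarrow> matsp.dim (S k) \<le> matsp.dim (S j)"
    using ex_has_least_nat[of "\<lambda>k. k > 0" 1 "\<lambda>k. matsp.dim (S k)"] by auto
  have "S (k + k) \<subseteq> S k"
    unfolding S_def
    by (auto simp: matrix_power_add matrix_mul_assoc[symmetric] intro!: imageI mult_mem power_mem b)
  then have "S (k + k) = S k"
    using matsp.subspace_dim_equal[OF sub sub] min[of "k + k"] k by blast
  moreover have "matrix_power b k \<in> S k"
    using one_mem unfolding S_def by force
  ultimately show ?thesis
    using that[OF k] unfolding S_def by auto
qed

end

section \<open>Corners, fixed spaces and counting linear conditions\<close>

text \<open>For an idempotent \<open>e\<close> of a commutative algebra \<open>A\<close> this is the
  ideal e A.\<close>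

definition corner :: "('a::field ^ 'n ^ 'n) set \<Rightarrow> 'a ^ 'n ^ 'n \<Rightarrow> ('a ^ 'n ^ 'n) set" where
  "corner A e = {a \<in> A. e ** a = a}"

text \<open>For an idempotent \<open>e\<close> this is the image of \<open>e\<close>.\<close>

definition fixed_space :: "'a::field ^ 'n ^ 'n \<Rightarrow> ('a ^ 'n) set" where
  "fixed_space e = {v. e *v v = v}"

lemma subspace_fixed_space: "vec.subspace (fixed_space e)"
  unfolding fixed_space_def
  by (rule vec.subspaceI) (auto simp: matrix_vector_right_distrib vector_scalar_commute)

text \<open>Each condition is the vanishing of one linear functional and lowers the dimension by at
  most one.\<close>

lemma dim_common_zeros:
  fixes W :: "('a::field ^ 'n) set" and I :: "('a ^ 'n ^ 'n) set"
  assumes "finite I" and W: "vec.subspace W"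
  shows "vec.dim W \<le> vec.dim {v \<in> W. \<forall>a\<in>I. (a *v v) $ i = 0} + card I"
  using \<open>finite I\<close>
proof induction
  case (insert a I)
  define K where "K = {v \<in> W. \<forall>a\<in>I. (a *v v) $ i = 0}"
  define K' where "K' = {v \<in> K. (a *v v) $ i = 0}"
  have K: "vec.subspace K"
    unfolding K_def using W
    by (auto simp: vec.subspace_def matrix_vector_right_distrib vector_scalar_commute)
  have "vec.dim K \<le> vec.dim K' + 1"
  proof (cases "K \<subseteq> K'")
    case True
    then show ?thesis
      using vec.dim_subset[of K K'] by simp
  next
    case False
    then obtain w where w: "w \<in> K" "(a *v w) $ i \<noteq> 0"
      by (auto simp: K'_def)
    have "K \<subseteq> vec.span (insert w K')"
    proof
      fix v assume v: "v \<in> K"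
      \<comment> \<open>With this \<open>c\<close> the new functional vanishes on
        \<open>v - c *s w\<close>, so \<open>K\<close> is spanned by \<open>K'\<close> and the
        single vector \<open>w\<close>.\<close>
      define c where "c = (a *v v) $ i / (a *v w) $ i"
      have "v - c *s w \<in> K'"
        using v w K unfolding K'_def
        by (auto simp: matrix_vector_mult_diff_distrib vector_scalar_commute c_def
            intro: vec.subspace_diff vec.subspace_scale)
      then have "v - c *s w \<in> vec.span K'"
        by (rule vec.span_base)
      then show "v \<in> vec.span (insert w K')"
        unfolding vec.span_insert by blast
    qed
    then have "vec.dim K \<le> vec.dim (insert w K')"
      by (rule vec.dim_mono)
    then show ?thesis
      by (auto simp: vec.dim_insert split: if_splits)
  qed
  moreover have "K' = {v \<in> W. \<forall>a\<in>insert a I. (a *v v) $ i = 0}"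
    by (auto simp: K'_def K_def)
  ultimately show ?case
    using insert by (simp add: K_def)
qed simp

section \<open>Primitive idempotents\<close>

text \<open>Since \<open>e ** f = f\<close> places \<open>f\<close> in e A, the assumption
  \<open>e_primitive\<close> says that this algebra, with unit \<open>e\<close>, has only the
  trivial idempotents.\<close>

locale primitive_corner = commutative_matrices A
  for A :: "('k::alg_closed_field ^ 'n ^ 'n) set" +
  fixes e :: "'k ^ 'n ^ 'n"
  assumes e_mem: "e \<in> A" and e_idem: "e ** e = e" and e_nonzero: "e \<noteq> 0"
    and e_primitive: "\<And>f. f \<in> A \<Longrightarrow> f ** f = f \<Longrightarrow> e ** f = f \<Longrightarrow> f = 0 \<or> f = e"
begin

abbreviation "B \<equiv> corner A e"
abbreviation "W \<equiv> fixed_space e"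

definition "nil = {a \<in> B. \<exists>k. matrix_power a k = 0}"
text \<open>The products \<open>n *v w\<close> alone need not be closed under addition, hence the
  span.\<close>

definition "radW = vec.span {n *v w |n w. n \<in> nil \<and> w \<in> W}"
definition "socW = {w \<in> W. \<forall>n\<in>nil. n *v w = 0}"

lemma B_D: "b \<in> B \<Longrightarrow> b \<in> A" "b \<in> B \<Longrightarrow> e ** b = b" "b \<in> B \<Longrightarrow> b ** e = b"
  using commute[OF e_mem] by (auto simp: corner_def)

lemma e_in_B: "e \<in> B"
  by (simp add: corner_def e_mem e_idem)

lemma mult_B: "b \<in> B \<Longrightarrow> a \<in> A \<Longrightarrow> b ** a \<in> B"
  by (auto simp: corner_def mult_mem matrix_mul_assoc)

lemma e_mult_B: "a \<in> A \<Longrightarrow> e ** a \<in> B"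
  by (rule mult_B[OF e_in_B])

lemma subspace_B: "matsp.subspace B"
  by (rule matsp.subspaceI)
     (auto simp: corner_def matrix_add_ldistrib matrix_scale_mult_right add_mem scale_mem zero_mem)

lemma B_vec_in_W: "b \<in> B \<Longrightarrow> b *v v \<in> W"
  by (simp add: fixed_space_def matrix_vector_mul_assoc B_D)

lemma nil_in_B: "n \<in> nil \<Longrightarrow> n \<in> B"
  by (simp add: nil_def)

section \<open>The corner algebra: scalars plus nilpotents\<close>

text \<open>The Fitting relation b^k = b^(2k) x makes f = b^k x an idempotent of the corner with b^k
  f = b^k. By primitivity either f = 0, so b^k = 0, or f = e, which exhibits an inverse of b in the
  corner.\<close>

lemma nil_or_invertible:
  assumes b: "b \<in> B"
  shows "b \<in> nil \<or> (\<exists>y. b ** y = e)"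
proof -
  obtain k x where k: "k > 0" and x: "x \<in> A" and eq: "matrix_power b k = matrix_power b (k + k) ** x"
    using fitting[OF B_D(1)[OF b]] .
  let ?p = "matrix_power b k"
  define f where "f = ?p ** x"
  have p: "?p \<in> A" using power_mem B_D b by blast
  \<comment> \<open>Here k must be positive: the zeroth power is \<open>mat 1\<close>, which need
    not lie in the corner.\<close>
  have ep: "e ** ?p = ?p"
    using k b by (cases k) (auto simp: matrix_mul_assoc B_D)
  have pf: "?p ** f = ?p"
    using eq by (simp add: f_def matrix_power_add matrix_mul_assoc)
  have "f ** f = ?p ** f ** x"
    using p x by (simp add: f_def) (metis commute matrix_mul_assoc mult_mem)
  then have "f ** f = f"
    by (simp add: pf) (simp add: f_def)
  moreover have "f \<in> A" "e ** f = f"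
    using p x by (simp_all add: f_def mult_mem matrix_mul_assoc ep)
  ultimately consider "f = 0" | "f = e"
    using e_primitive by blast
  then show ?thesis
  proof cases
    case 1
    then have "?p = 0" using pf by simp
    then show ?thesis using b by (auto simp: nil_def)
  next
    case 2
    obtain j where "k = Suc j" using k gr0_implies_Suc by blast
    then have "b ** (matrix_power b j ** x) = e"
      using 2 by (simp add: f_def matrix_mul_assoc)
    then show ?thesis by blast
  qed
qed

text \<open>Horner evaluation in the corner algebra: its unit is \<open>e\<close>, so a constant c
  becomes c e.\<close>

definition eval_at :: "'k ^ 'n ^ 'n \<Rightarrow> 'k poly \<Rightarrow> 'k ^ 'n ^ 'n" where
  "eval_at a p = fold_coeffs (\<lambda>c M. matrix_scale c e + a ** M) p 0"

lemma eval_at_0 [simp]: "eval_at a 0 = 0"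
  by (simp add: eval_at_def)

lemma eval_at_pCons [simp]: "eval_at a (pCons c p) = matrix_scale c e + a ** eval_at a p"
  by (cases "c = 0 \<and> p = 0") (auto simp: eval_at_def)

lemma eval_at_add: "eval_at a (p + q) = eval_at a p + eval_at a q"
  by (induction p q rule: poly_induct2)
     (simp_all add: matsp.scale_left_distrib matrix_add_ldistrib algebra_simps)

lemma eval_at_smult: "eval_at a (smult c p) = matrix_scale c (eval_at a p)"
  by (induction p) (simp_all add: matsp.scale_right_distrib matrix_scale_mult_right)

lemma eval_at_sum: "eval_at a (sum f I) = (\<Sum>i\<in>I. eval_at a (f i))"
  by (induction I rule: infinite_finite_induct) (simp_all add: eval_at_add)

lemma eval_at_in_B: "a \<in> B \<Longrightarrow> eval_at a p \<in> B"
proof (induction p)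
  case (pCons c p)
  then show ?case
    using matsp.subspace_add[OF subspace_B] matsp.subspace_scale[OF subspace_B] e_in_B mult_B B_D
    by simp
qed (use matsp.subspace_0[OF subspace_B] in simp)

lemma eval_at_root_factor:
  assumes "a \<in> B"
  shows "eval_at a ([:-c, 1:] * q) = (a - matrix_scale c e) ** eval_at a q"
  using B_D(2)[OF eval_at_in_B[OF assms]]
  using eval_at_add[of a "pCons 0 q" "- smult c q"] eval_at_smult[of a "-c" q]
  by (simp add: matrix_diff_rdistrib matrix_scale_mult_left)

lemma annihilating_poly:
  obtains p where "p \<noteq> 0" "eval_at a p = 0"
proof -
  define f where "f i = eval_at a (monom 1 i)" for i
  \<comment> \<open>The range starts at 0 and includes its endpoint, so there is one more power than
    the dimension and a relation must exist.\<close>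
  define I where "I = {..matsp.dim (UNIV :: ('k ^ 'n ^ 'n) set)}"
  have "\<exists>u. (\<Sum>i\<in>I. matrix_scale (u i) (f i)) = 0 \<and> (\<exists>i\<in>I. u i \<noteq> 0)"
  proof (rule ccontr)
    assume "\<not> ?thesis"
    then have "inj_on f I" "matsp.independent (f ` I)"
      using matsp.independent_family[of I f] by (auto simp: I_def)
    then have "card I \<le> matsp.dim (UNIV :: ('k ^ 'n ^ 'n) set)"
      using matsp.independent_card_le_dim[of "f ` I" UNIV] by (simp add: card_image)
    then show False by (simp add: I_def)
  qed
  then obtain u j where u: "(\<Sum>i\<in>I. matrix_scale (u i) (f i)) = 0" and j: "j \<in> I" "u j \<noteq> 0"
    by blast
  define p where "p = (\<Sum>i\<in>I. smult (u i) (monom 1 i))"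
  have "coeff p j = u j"
    using j by (simp add: p_def coeff_sum I_def if_distrib cong: if_cong)
  then have "p \<noteq> 0" using j by auto
  moreover have "eval_at a p = 0"
    using u by (simp add: p_def eval_at_sum eval_at_smult f_def)
  ultimately show ?thesis using that by blast
qed

text \<open>Algebraic closedness enters here. A root c of an annihilating polynomial p of least
  degree gives p = (X - c) q with q(a) nonzero. Then a - c e kills q(a), so it is not invertible in
  the corner and must be nilpotent.\<close>

lemma scalar_plus_nil:
  assumes a: "a \<in> B"
  obtains c n where "n \<in> nil" "a = matrix_scale c e + n"
proof -
  obtain p where p: "p \<noteq> 0" "eval_at a p = 0"
    and min: "\<And>q. q \<noteq> 0 \<Longrightarrow> eval_at a q = 0 \<Longrightarrow> degree p \<le> degree q"
    using ex_has_least_nat[of "\<lambda>p. p \<noteq> 0 \<and> eval_at a p = 0" _ degree] annihilating_poly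
    by metis
  have "degree p > 0"
  proof (rule ccontr)
    assume "\<not> degree p > 0"
    then obtain c where "p = [:c:]" using degree_eq_zeroE by blast
    then show False using p e_nonzero by auto
  qed
  then obtain c where "poly p c = 0"
    using alg_closed_imp_poly_has_root by blast
  then obtain q where pq: "p = [:-c, 1:] * q"
    using poly_eq_0_iff_dvd by (metis dvdE)
  have q: "q \<noteq> 0" using p pq by auto
  have "degree p = Suc (degree q)"
    using q by (simp add: pq degree_mult_eq del: mult_pCons_left)
  then have evq: "eval_at a q \<noteq> 0"
    using min[OF q] by auto
  define b where "b = a - matrix_scale c e"
  have b: "b \<in> B"
    unfolding b_def using subspace_B a e_in_B
    by (intro matsp.subspace_diff matsp.subspace_scale)
  have "b ** eval_at a q = 0"
    using p pq eval_at_root_factor[OF a] by (simp add: b_def del: mult_pCons_left)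
  have "b \<in> nil"
  proof (rule ccontr)
    assume "b \<notin> nil"
    then obtain y where "b ** y = e" using nil_or_invertible[OF b] by blast
    then have "eval_at a q = eval_at a q ** (b ** y)"
      using B_D(3)[OF eval_at_in_B[OF a]] by simp
    also have "\<dots> = b ** eval_at a q ** y"
      using commute[OF B_D(1)[OF b] B_D(1)[OF eval_at_in_B[OF a]]] by (simp add: matrix_mul_assoc)
    finally show False using \<open>b ** eval_at a q = 0\<close> evq by simp
  qed
  moreover have "a = matrix_scale c e + b" by (simp add: b_def)
  ultimately show ?thesis by (rule that)
qed

section \<open>Submodules, radical and socle of \<open>W\<close>\<close>

lemma subspace_W: "vec.subspace W"
  by (rule subspace_fixed_space)

lemma subspace_radW: "vec.subspace radW"
  by (simp add: radW_def)

lemma subspace_socW: "vec.subspace socW"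
  using subspace_W unfolding socW_def
  by (auto simp: vec.subspace_def matrix_vector_right_distrib vector_scalar_commute)

lemma radW_I: "n \<in> nil \<Longrightarrow> w \<in> W \<Longrightarrow> n *v w \<in> radW"
  unfolding radW_def by (rule vec.span_base) blast

lemma radW_subset_W: "radW \<subseteq> W"
  unfolding radW_def
  by (rule vec.span_minimal[OF _ subspace_W]) (auto intro: B_vec_in_W nil_in_B)

lemma socW_subset_W: "socW \<subseteq> W"
  by (auto simp: socW_def)

definition submodule :: "('k ^ 'n) set \<Rightarrow> bool" where
  "submodule U \<longleftrightarrow> vec.subspace U \<and> U \<subseteq> W \<and> (\<forall>b\<in>B. \<forall>u\<in>U. b *v u \<in> U)"

lemma submodule_W: "submodule W"
  by (auto simp: submodule_def subspace_W B_vec_in_W)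

lemma subspace_image: "vec.subspace U \<Longrightarrow> vec.subspace ((*v) M ` U)"
  for M :: "'k ^ 'n ^ 'n"
  by (rule vec.subspaceI)
     (use vec.subspace_0 in force, auto simp: matrix_vector_right_distrib[symmetric]
       vector_scalar_commute[symmetric] intro!: imageI intro: vec.subspace_add vec.subspace_scale)

text \<open>By commutativity, multiplication by \<open>n\<close> is a module endomorphism.\<close>

lemma submodule_image:
  assumes "submodule U" "n \<in> B"
  shows "submodule ((*v) n ` U)" "(*v) n ` U \<subseteq> U"
proof -
  have "b *v (n *v u) = n *v (b *v u)" if "b \<in> B" for b u
    using commute[OF B_D(1) B_D(1), OF that assms(2)] by (simp add: matrix_vector_mul_assoc)
  then show "submodule ((*v) n ` U)" "(*v) n ` U \<subseteq> U"
    using assms by (auto simp: submodule_def subspace_image)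
qed

text \<open>A nonzero submodule \<open>M\<close> of \<open>U\<close> of least dimension lies in the
  socle: if a nilpotent n does not kill \<open>M\<close>, minimality gives n M = M.\<close>

lemma socle_nonzero:
  assumes U: "submodule U" "U \<noteq> {0}"
  shows "\<exists>u\<in>U \<inter> socW. u \<noteq> 0"
proof -
  obtain M where M: "submodule M" "M \<noteq> {0}" "M \<subseteq> U"
    and min: "\<And>M'. submodule M' \<Longrightarrow> M' \<noteq> {0} \<Longrightarrow> M' \<subseteq> U \<Longrightarrow> vec.dim M \<le> vec.dim M'"
    using ex_has_least_nat[of "\<lambda>M. submodule M \<and> M \<noteq> {0} \<and> M \<subseteq> U" U vec.dim] U by auto
  have "n *v m = 0" if n: "n \<in> nil" and m: "m \<in> M" for n m
  proof (rule ccontr)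
    assume nm: "n *v m \<noteq> 0"
    let ?I = "(*v) n ` M"
    have I: "submodule ?I" "?I \<subseteq> M"
      using submodule_image M(1) nil_in_B[OF n] by blast+
    have "?I \<noteq> {0}" using nm m by blast
    then have "vec.dim M \<le> vec.dim ?I"
      using min I M(3) by blast
    then have eq: "?I = M"
      using vec.subspace_dim_equal I M(1) by (auto simp: submodule_def)
    \<comment> \<open>Iterating n M = M reaches a vanishing power of n, which would make
      \<open>M\<close> zero.\<close>
    have "M \<subseteq> (*v) (matrix_power n k) ` M" for k
    proof (induction k)
      case (Suc k)
      then have "(*v) n ` M \<subseteq> (*v) n ` (*v) (matrix_power n k) ` M"
        by (rule image_mono)
      then show ?case
        by (simp add: eq image_image matrix_vector_mul_assoc)
    qed simp
    moreover obtain k where "matrix_power n k = 0"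
      using n by (auto simp: nil_def)
    ultimately have "M \<subseteq> (*v) 0 ` M" by metis
    then show False using m nm by auto
  qed
  then have "M \<subseteq> socW"
    using M(1) by (auto simp: socW_def submodule_def)
  moreover obtain u where "u \<in> M" "u \<noteq> 0"
    using M(1,2) by (auto simp: submodule_def dest: vec.subspace_0)
  ultimately show ?thesis using M(3) by blast
qed

section \<open>Cyclic and cocyclic modules\<close>

text \<open>Nakayama: a maximal proper submodule contains N W. If B v were proper, such a submodule
  above it would contain \<open>v\<close> and \<open>radW\<close>, hence all of \<open>W\<close>. So
  b |-> b v maps \<open>B\<close> onto \<open>W\<close>.\<close>

lemma cyclic_bound:
  assumes v: "v \<in> W" and gen: "W \<subseteq> vec.span (insert v radW)"
  shows "vec.dim W \<le> matsp.dim B"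
proof -
  define C where "C = (\<lambda>b. b *v v) ` B"
  have C: "submodule C"
    unfolding submodule_def
  proof (intro conjI)
    show "vec.subspace C"
      unfolding C_def
      by (rule vec.subspaceI)
         (use matsp.subspace_0[OF subspace_B] in force,
          auto simp: matrix_vector_mult_add_rdistrib[symmetric] matrix_scale_vec[symmetric]
            intro!: imageI matsp.subspace_add[OF subspace_B] matsp.subspace_scale[OF subspace_B])
    show "C \<subseteq> W" by (auto simp: C_def B_vec_in_W)
    show "\<forall>b\<in>B. \<forall>u\<in>C. b *v u \<in> C"
      by (auto simp: C_def matrix_vector_mul_assoc intro!: imageI mult_B B_D)
  qed
  have vC: "v \<in> C"
    unfolding C_def using v e_in_B by (force simp: fixed_space_def)
  have "C = W"
  proof (rule ccontr)
    assume "C \<noteq> W"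
    then have "submodule C \<and> C \<noteq> W \<and> C \<subseteq> C" using C by blast
    then obtain M where M: "submodule M" "M \<noteq> W" "C \<subseteq> M"
      and max: "\<And>M'. submodule M' \<Longrightarrow> M' \<noteq> W \<Longrightarrow> C \<subseteq> M' \<Longrightarrow> vec.dim M' \<le> vec.dim M"
      using ex_has_greatest_nat[of "\<lambda>M. submodule M \<and> M \<noteq> W \<and> C \<subseteq> M" C vec.dim "Suc CARD('n)"]
      by (metis dim_subset_UNIV_cart_gen less_Suc_eq_le)
    have subM: "vec.subspace M" and MW: "M \<subseteq> W" using M by (auto simp: submodule_def)
    have "n *v w \<in> M" if n: "n \<in> nil" and w: "w \<in> W" for n w
    proof -
      let ?nW = "(*v) n ` W"
      have nW: "submodule ?nW" "?nW \<subseteq> W"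
        using submodule_image[OF submodule_W nil_in_B[OF n]] by auto
      \<comment> \<open>The submodule M + n W contains \<open>M\<close>, so by maximality it is
        \<open>M\<close> or \<open>W\<close>; the first case gives the claim.\<close>
      define M' where "M' = {x + y |x y. x \<in> M \<and> y \<in> ?nW}"
      have M'sub: "vec.subspace M'"
        unfolding M'_def using subM nW by (intro vec.subspace_sums) (auto simp: submodule_def)
      have M': "submodule M'"
        unfolding submodule_def
      proof (intro conjI ballI)
        show "M' \<subseteq> W"
          unfolding M'_def using MW nW(2) subspace_W by (auto intro!: vec.subspace_add)
        fix b u assume "b \<in> B" "u \<in> M'"
        then show "b *v u \<in> M'"
          using M(1) nW(1) unfolding M'_def submodule_def
          by (clarsimp simp: matrix_vector_right_distrib) metis
      qed (rule M'sub)
      have MM': "M \<subseteq> M'" and nM': "n *v w \<in> M'"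
      proof -
        have "0 \<in> ?nW" "0 \<in> M"
          using nW(1) subM vec.subspace_0 by (auto simp: submodule_def)
        then show "M \<subseteq> M'" "n *v w \<in> M'"
          using w unfolding M'_def by force+
      qed
      show ?thesis
      proof (cases "M' = W")
        case False
        then have "M = M'"
          using vec.subspace_dim_equal[OF subM M'sub MM'] max[OF M'] M(3) MM' by blast
        then show ?thesis using nM' by simp
      next
        case True
        \<comment> \<open>Substituting W = M + n W into itself yields W = M + n^k W for every k, and
          a vanishing power then contradicts that \<open>M\<close> is proper.\<close>
        have "\<exists>m\<in>M. \<exists>y\<in>W. u = m + matrix_power n k *v y" if "u \<in> W" for k u
        proof (induction k)
          case 0
          then show ?case
            using that vec.subspace_0[OF subM] by force
        next
          case (Suc k)
          then obtain m y where m: "m \<in> M" and y: "y \<in> W" and u: "u = m + matrix_power n k *v y"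
            by blast
          obtain m' y' where m': "m' \<in> M" and y': "y' \<in> W" and y_eq: "y = m' + n *v y'"
            using y True unfolding M'_def by blast
          have nA: "n \<in> A" using n nil_in_B B_D by blast
          \<comment> \<open>For k = 0 the power need not lie in \<open>B\<close>, but on
            \<open>W\<close> it acts as its product with \<open>e\<close>, which does.\<close>
          have "matrix_power n k *v m' = (e ** matrix_power n k) *v m'"
          proof -
            have "e *v m' = m'" using m' MW by (auto simp: fixed_space_def)
            then show ?thesis
              using commute[OF e_mem power_mem[OF nA]] by (metis matrix_vector_mul_assoc)
          qed
          then have "matrix_power n k *v m' \<in> M"
            using M(1) m' e_mult_B[OF power_mem[OF nA]] by (auto simp: submodule_def)
          then have "m + matrix_power n k *v m' \<in> M"
            using m vec.subspace_add[OF subM] by blast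
          moreover have "u = (m + matrix_power n k *v m') + matrix_power n (Suc k) *v y'"
            using commute[OF nA power_mem[OF nA]]
            by (simp add: u y_eq matrix_vector_right_distrib matrix_vector_mul_assoc)
          ultimately show ?case using y' by blast
        qed
        moreover obtain k where "matrix_power n k = 0"
          using n by (auto simp: nil_def)
        ultimately have "W \<subseteq> M"
          by (metis add.right_neutral matrix_vector_mult_0 subsetI)
        then show ?thesis using M(2) MW by blast
      qed
    qed
    then have "radW \<subseteq> M"
      unfolding radW_def by (intro vec.span_minimal[OF _ subM]) blast
    then have "vec.span (insert v radW) \<subseteq> M"
      using vC M(3) by (intro vec.span_minimal[OF _ subM]) blast
    then show False using gen M(2) MW by blast
  qed
  obtain bs where bs: "bs \<subseteq> B" "matsp.independent bs" "B \<subseteq> matsp.span bs" "card bs = matsp.dim B"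
    using matsp.basis_exists .
  have fin: "finite bs" using bs(2) matsp.finiteI_independent by blast
  let ?X = "(\<lambda>b. b *v v) ` bs"
  have "matsp.span bs \<subseteq> {M. M *v v \<in> vec.span ?X}"
  proof (rule matsp.span_minimal)
    show "matsp.subspace {M. M *v v \<in> vec.span ?X}"
      by (auto intro!: matsp.subspaceI vec.span_zero vec.span_add vec.span_scale
          simp: matrix_vector_mult_add_rdistrib matrix_scale_vec)
  qed (auto intro: vec.span_base)
  then have "C \<subseteq> vec.span ?X"
    using bs(3) by (auto simp: C_def)
  then have "W \<subseteq> vec.span ?X"
    using \<open>C = W\<close> by simp
  then have "vec.dim W \<le> card ?X"
    using fin by (intro vec.dim_le_card) auto
  also have "\<dots> \<le> matsp.dim B"
    using card_image_le[OF fin] bs(4) by metis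
  finally show ?thesis .
qed

text \<open>If the socle is spanned by \<open>u\<close> and \<open>u $ i \<noteq> 0\<close>, then the vectors \<open>v\<close> with \<open>(B v) $ i = 0\<close> form
  a submodule missing the socle, so \<open>(v, b) \<mapsto> (b v) $ i\<close> is nondegenerate in \<open>v\<close>.\<close>

lemma cocyclic_bound:
  assumes soc: "socW \<subseteq> vec.span {w}"
  shows "vec.dim W \<le> matsp.dim B"
proof (rule ccontr)
  assume neg: "\<not> ?thesis"
  then have "vec.dim W \<noteq> 0" by linarith
  then have "W \<noteq> {0}" by auto
  then obtain u where u: "u \<in> socW" "u \<noteq> 0"
    using socle_nonzero[OF submodule_W] by blast
  then obtain i where ui: "u $ i \<noteq> 0" by (metis vec_eq_iff zero_index)
  obtain bs where bs: "bs \<subseteq> B" "matsp.independent bs" "B \<subseteq> matsp.span bs" "card bs = matsp.dim B"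
    using matsp.basis_exists .
  have fin: "finite bs" using bs(2) matsp.finiteI_independent by blast
  define U where "U = {v \<in> W. \<forall>b\<in>B. (b *v v) $ i = 0}"
  \<comment> \<open>Testing on a basis turns membership in \<open>U\<close> into dim B linear
    conditions, so a violated bound leaves \<open>U\<close> nonzero.\<close>
  define U' where "U' = {v \<in> W. \<forall>b\<in>bs. (b *v v) $ i = 0}"
  have "U' \<subseteq> U"
  proof
    fix v assume v: "v \<in> U'"
    have "matsp.span bs \<subseteq> {M. (M *v v) $ i = 0}"
      using v by (intro matsp.span_minimal)
       (auto intro!: matsp.subspaceI simp: U'_def matrix_vector_mult_add_rdistrib matrix_scale_vec)
    then show "v \<in> U" using v bs(3) by (auto simp: U_def U'_def)
  qed
  moreover have "vec.dim W \<le> vec.dim U' + matsp.dim B"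
    using dim_common_zeros[OF fin subspace_W, of i] bs(4) by (simp add: U'_def)
  ultimately have "vec.dim U \<noteq> 0"
    using neg vec.dim_subset[of U' U] by linarith
  then have "U \<noteq> {0}" by auto
  moreover have "submodule U"
    using subspace_W unfolding submodule_def U_def
    by (auto simp: vec.subspace_def matrix_vector_right_distrib vector_scalar_commute B_vec_in_W
        matrix_vector_mul_assoc mult_B B_D)
  ultimately obtain x where x: "x \<in> U" "x \<in> socW" "x \<noteq> 0"
    using socle_nonzero by blast
  obtain c d where "x = c *s w" "u = d *s w"
    using subsetD[OF soc x(2)] subsetD[OF soc u(1)] by (auto simp: vec.span_singleton)
  then have "u = (d / c) *s x" using x(3) by auto
  \<comment> \<open>The condition defining \<open>U\<close> is applied with b = e, which fixes
    \<open>x\<close>.\<close>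
  moreover have "x $ i = 0"
    using x(1) e_in_B by (force simp: U_def fixed_space_def)
  ultimately show False using ui by simp
qed


section \<open>Maps from W / N W to the socle\<close>

lemma corner_bound:
  assumes maximal: "matrix_centralizer A \<subseteq> A" and dimW: "vec.dim W \<le> 6"
  shows "vec.dim W \<le> matsp.dim B"
proof (rule ccontr)
  assume neg: "\<not> ?thesis"
  obtain C0 where C0: "C0 \<subseteq> radW" "vec.independent C0" "radW \<subseteq> vec.span C0" "card C0 = vec.dim radW"
    using vec.basis_exists .
  obtain C1 where C1: "C0 \<subseteq> C1" "C1 \<subseteq> W" "vec.independent C1" "W \<subseteq> vec.span C1"
    using vec.maximal_independent_subset_extend[of C0 W] C0 radW_subset_W by blast
  obtain D where D: "D \<subseteq> socW" "vec.independent D" "socW \<subseteq> vec.span D" "card D = vec.dim socW"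
    using vec.basis_exists .
  have cardC1: "card C1 = vec.dim W"
    using vec.basis_card_eq_dim C1 by blast
  have fin: "finite C0" "finite C1" "finite D"
    using C0 C1 D vec.finiteI_independent by blast+
  \<comment> \<open>The vectors in \<open>R\<close> represent a basis of W / N W, so
    \<open>card R\<close> and \<open>card D\<close> are the r and s of the outline.\<close>
  define R where "R = C1 - C0"
  have finR: "finite R" using fin by (simp add: R_def)
  have card_sum: "card C0 + card R = vec.dim W"
    using C1(1) fin cardC1 card_mono[of C1 C0] by (simp add: R_def card_Diff_subset)
  have R2: "card R \<ge> 2"
  proof (rule ccontr)
    assume "\<not> ?thesis"
    then consider "R = {}" | v where "R = {v}"
      using finR by (metis One_nat_def card_0_eq card_1_singletonE less_2_cases not_le)
    then obtain v where v: "v \<in> W" "R \<subseteq> {v}"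
      using C1(2) vec.subspace_0[OF subspace_W] by cases (auto simp: R_def)
    then have "C1 \<subseteq> insert v radW" using C0(1) by (auto simp: R_def)
    then show False
      using cyclic_bound[OF v(1)] C1(4) vec.span_mono neg by blast
  qed
  have D2: "card D \<ge> 2"
  proof (rule ccontr)
    assume "\<not> ?thesis"
    then consider "D = {}" | w where "D = {w}"
      using fin by (metis One_nat_def card_0_eq card_1_singletonE less_2_cases not_le)
    then obtain w where "D \<subseteq> {w}" by cases auto
    then show False
      using cocyclic_bound D(3) vec.span_mono neg by blast
  qed
  have radW_span: "vec.span C0 = radW"
    using C0 vec.span_minimal[OF _ subspace_radW] by blast
  have not_rad: "b \<notin> radW" if "b \<in> R" for b
  proof -
    have "vec.span C0 \<subseteq> vec.span (C1 - {b})"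
      using that C1(1) by (intro vec.span_mono) (auto simp: R_def)
    then show ?thesis
      using that C1(3) by (auto simp: radW_span R_def vec.dependent_def)
  qed
  define f where "f w b = vec.construct C1 (\<lambda>c. if c = b then w else 0)" for w b :: "'k ^ 'n"
  have f_lin: "Vector_Spaces.linear (*s) (*s) (f w b)" for w b
    unfolding f_def by (rule vec.linear_construct[OF C1(3)])
  have f_C1: "f w b c = (if c = b then w else 0)" if "c \<in> C1" for w b c
    using that by (simp add: f_def vec.construct_basis[OF C1(3)])
  \<comment> \<open>The map kills N W, sends \<open>b\<close> to \<open>w\<close> and the other
    vectors of \<open>C1\<close> to 0. Composing with \<open>e\<close> makes it factor through the
    projection onto \<open>W\<close>.\<close>
  define T where "T w b = matrix (f w b) ** e" for w b
  have T_e: "T w b *v (e *v v) = T w b *v v" for w b v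
    by (simp add: T_def matrix_vector_mul_assoc matrix_mul_assoc[symmetric] e_idem)
  have T_C1: "T w b *v c = (if c = b then w else 0)" if "c \<in> C1" for w b c
  proof -
    have "e *v c = c" using that C1(2) by (auto simp: fixed_space_def)
    then show ?thesis
      using f_C1[OF that] f_lin by (simp add: T_def matrix_works flip: matrix_vector_mul_assoc)
  qed
  have T_soc: "T w b *v v \<in> socW" if "w \<in> D" for w b v
  proof -
    have "vec.span C1 \<subseteq> {v. T w b *v v \<in> socW}"
      using that D(1) vec.subspace_0[OF subspace_socW]
      by (intro vec.span_minimal)
         (auto simp: T_C1 matrix_vector_right_distrib vector_scalar_commute
           intro!: vec.subspaceI vec.subspace_add[OF subspace_socW] vec.subspace_scale[OF subspace_socW])
    moreover have "e *v v \<in> W" by (rule B_vec_in_W[OF e_in_B])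
    ultimately show ?thesis using C1(4) T_e by fastforce
  qed
  have T_rad: "T w b *v v = 0" if "b \<in> R" "v \<in> radW" for w b v
  proof -
    have "vec.span C0 \<subseteq> {v. T w b *v v = 0}"
      using that(1) C1(1)
      by (intro vec.span_minimal)
         (auto simp: T_C1 R_def matrix_vector_right_distrib vector_scalar_commute intro!: vec.subspaceI)
    then show ?thesis using that(2) radW_span by blast
  qed
  have T_A: "T w b \<in> A" if wb: "w \<in> D" "b \<in> R" for w b
  proof -
    \<comment> \<open>On \<open>W\<close>, a acts as c plus a nilpotent n. Both products of n with T
      vanish, since T kills N W and n kills the socle; only the scalar c remains.\<close>
    have "T w b ** a = a ** T w b" if a: "a \<in> A" for a
    proof -
      obtain c n where n: "n \<in> nil" and ea: "e ** a = matrix_scale c e + n"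
        using scalar_plus_nil[OF e_mult_B[OF a]] .
      have "T w b *v (a *v v) = a *v (T w b *v v)" for v
      proof -
        have ev: "e *v v \<in> W" by (rule B_vec_in_W[OF e_in_B])
        have "T w b *v (a *v v) = T w b *v ((e ** a) *v (e *v v))"
        proof -
          have "T w b *v (a *v v) = T w b *v (e *v (a *v v))" by (simp add: T_e)
          also have "e *v (a *v v) = (e ** a) *v (e *v v)"
            using B_D(3)[OF e_mult_B[OF a]] by (simp add: matrix_vector_mul_assoc)
          finally show ?thesis .
        qed
        also have "\<dots> = c *s (T w b *v v)"
          using T_rad[OF wb(2) radW_I[OF n ev]]
          by (simp add: ea matrix_vector_mult_add_rdistrib matrix_scale_vec
              matrix_vector_right_distrib vector_scalar_commute T_e)
        also have "\<dots> = (e ** a) *v (T w b *v v)"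
          using T_soc[OF wb(1), of b v] n
          by (simp add: ea matrix_vector_mult_add_rdistrib matrix_scale_vec socW_def fixed_space_def)
        also have "\<dots> = a *v (e *v (T w b *v v))"
          using commute[OF e_mem a] by (metis matrix_vector_mul_assoc)
        also have "e *v (T w b *v v) = T w b *v v"
          using T_soc[OF wb(1), of b v] by (simp add: socW_def fixed_space_def)
        finally show ?thesis .
      qed
      then show ?thesis by (simp add: matrix_eq flip: matrix_vector_mul_assoc)
    qed
    then show ?thesis using maximal by (auto simp: matrix_centralizer_def)
  qed
  have T_B: "T w b \<in> B" if wb: "w \<in> D" "b \<in> R" for w b
    using T_A[OF wb] T_soc[OF wb(1)]
    by (auto simp: corner_def matrix_eq socW_def fixed_space_def simp flip: matrix_vector_mul_assoc)
  have T_nil: "T w b \<in> nil" if wb: "w \<in> D" "b \<in> R" for w b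
  proof -
    obtain c n where n: "n \<in> nil" and T_eq: "T w b = matrix_scale c e + n"
      using scalar_plus_nil[OF T_B[OF wb]] .
    \<comment> \<open>A second vector b' of \<open>R\<close> is killed by T = c e + n, so c b' lies
      in N W; as b' does not, c = 0.\<close>
    have "\<not> R \<subseteq> {b}"
      using R2 card_mono[of "{b}" R] by auto
    then obtain b' where b': "b' \<in> R" "b' \<noteq> b" by blast
    have b'W: "b' \<in> W" "b' \<in> C1" using b' C1(2) by (auto simp: R_def)
    have "c *s b' + n *v b' = 0"
      using T_C1[OF b'W(2), of w b] b' b'W(1)
      by (simp add: T_eq matrix_vector_mult_add_rdistrib matrix_scale_vec fixed_space_def)
    then have cb: "c *s b' = - (n *v b')" by (simp add: eq_neg_iff_add_eq_0)
    have "c *s b' \<in> radW"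
      unfolding cb by (intro vec.subspace_neg subspace_radW radW_I n b'W)
    then have "inverse c *s (c *s b') \<in> radW"
      by (rule vec.subspace_scale[OF subspace_radW])
    then have "c = 0" using not_rad[OF b'(1)] by (cases "c = 0") auto
    then show ?thesis using n T_eq by simp
  qed
  obtain b0 where b0: "b0 \<in> R" using R2 by fastforce
  obtain w0 where w0: "w0 \<in> D" using D2 by fastforce
  \<comment> \<open>Each \<open>w\<close> is the value at \<open>b0\<close> of a nilpotent element
    of \<open>B\<close>. Hence \<open>w0\<close> lies in both N W and the socle, which later
    separates \<open>e\<close> from the span of \<open>F\<close>.\<close>
  have D_rad: "D \<subseteq> radW"
  proof
    fix w assume w: "w \<in> D"
    have "T w b0 *v b0 = w" using b0 T_C1 by (simp add: R_def)
    then show "w \<in> radW"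
      using radW_I[OF T_nil[OF w b0], of b0] b0 C1(2) by (auto simp: R_def)
  qed
  have w0': "w0 \<in> radW" "w0 \<in> socW" "w0 \<noteq> 0"
    using w0 D_rad D(1,2) vec.dependent_zero by blast+
  define F where "F = (\<lambda>(w, b). T w b) ` (D \<times> R)"
  have fam: "inj_on (\<lambda>(w, b). T w b) (D \<times> R)" "matsp.independent F"
  proof -
    have zero: "u p = 0"
      if u: "(\<Sum>p\<in>D \<times> R. matrix_scale (u p) ((\<lambda>(w, b). T w b) p)) = 0" and p: "p \<in> D \<times> R" for u p
    proof -
      obtain w b where wb: "p = (w, b)" "w \<in> D" "b \<in> R" using p by blast
      \<comment> \<open>Applying the relation to \<open>b\<close> isolates the coefficients with
        second index \<open>b\<close>, leaving a relation among the independent vectors of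
        \<open>D\<close>.\<close>
      have "0 = (\<Sum>p\<in>D \<times> R. matrix_scale (u p) ((\<lambda>(w, b). T w b) p)) *v b"
        using u by simp
      also have "\<dots> = (\<Sum>w\<in>D. \<Sum>b'\<in>R. u (w, b') *s (T w b' *v b))"
        by (simp add: sum_matrix_vec matrix_scale_vec sum.cartesian_product case_prod_unfold)
      also have "\<dots> = (\<Sum>w\<in>D. \<Sum>b'\<in>R. if b' = b then u (w, b) *s w else 0)"
        using wb(3) by (intro sum.cong) (auto simp: T_C1 R_def)
      also have "\<dots> = (\<Sum>w\<in>D. u (w, b) *s w)"
        using wb(3) finR by simp
      finally have "(\<Sum>w\<in>D. u (w, b) *s w) = 0" by simp
      then show ?thesis
        using vec.independentD[OF D(2) fin(3) subset_refl, of "\<lambda>w. u (w, b)"] wb(1,2) by simp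
    qed
    show "inj_on (\<lambda>(w, b). T w b) (D \<times> R)" "matsp.independent F"
      unfolding F_def
      by (rule matsp.independent_family; use zero finR fin in blast)+
  qed
  have finF: "finite F" using finR fin by (simp add: F_def)
  have cardF: "card F = card D * card R"
    using fam(1) by (simp add: F_def card_image card_cartesian_product)
  have F_rad: "M *v v = 0" if "M \<in> matsp.span F" "v \<in> radW" for M v
  proof -
    have "matsp.span F \<subseteq> {M. M *v v = 0}"
      using that(2)
      by (intro matsp.span_minimal)
         (auto simp: F_def T_rad matrix_vector_mult_add_rdistrib matrix_scale_vec intro!: matsp.subspaceI)
    then show ?thesis using that(1) by blast
  qed
  have F_soc: "M *v v \<in> socW" if "M \<in> matsp.span F" for M v
  proof -
    have "matsp.span F \<subseteq> {M. M *v v \<in> socW}"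
      using vec.subspace_0[OF subspace_socW]
      by (intro matsp.span_minimal)
         (auto simp: F_def T_soc matrix_vector_mult_add_rdistrib matrix_scale_vec
           intro!: matsp.subspaceI vec.subspace_add[OF subspace_socW] vec.subspace_scale[OF subspace_socW])
    then show ?thesis using that by blast
  qed
  have e_w0: "e *v w0 = w0" using w0'(2) by (simp add: socW_def fixed_space_def)
  have "e \<notin> matsp.span F" using F_rad w0' e_w0 by metis
  then have ind: "matsp.independent (insert e F)" and "e \<notin> F"
    using matsp.independent_insertI[OF _ fam(2)] matsp.span_base by blast+
  then have card_eF: "card (insert e F) = card D * card R + 1"
    using finF cardF by simp
  have eF_B: "insert e F \<subseteq> B"
    using e_in_B T_B by (auto simp: F_def)
  have "card D * card R + 1 \<le> matsp.dim B"
    using matsp.independent_card_le_dim[OF eF_B ind] card_eF by simp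
  \<comment> \<open>The bound fails and dim W is at most 6, so dim B is at most 5.\<close>
  then have le4: "card D * card R \<le> 4" and dimB: "matsp.dim B \<le> 5"
    using neg dimW by auto
  have "card D * 2 \<le> card D * card R" "2 * card R \<le> card D * card R"
    using R2 D2 by (auto intro: mult_le_mono)
  then have two: "card D = 2" "card R = 2" using le4 R2 D2 by linarith+
  have spanB: "B \<subseteq> matsp.span (insert e F)"
    using matsp.card_ge_dim_independent[OF eF_B ind] card_eF dimB two by simp
  \<comment> \<open>Write n as c e plus an element of the span of \<open>F\<close>. At
    \<open>w0\<close> both n and that element vanish while \<open>e\<close> fixes it, so c = 0 and n
    maps into the socle.\<close>
  have "n *v v \<in> socW" if n: "n \<in> nil" for n v
  proof -
    obtain c where c: "n - matrix_scale c e \<in> matsp.span F"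
      using spanB nil_in_B[OF n] by (auto simp: matsp.span_insert)
    have "n *v w0 = 0" using n w0'(2) by (simp add: socW_def)
    then have "c *s w0 = 0"
      using F_rad[OF c w0'(1)] e_w0 by (simp add: matrix_vector_mult_diff_rdistrib matrix_scale_vec)
    then have "c = 0" using w0'(3) by simp
    then show ?thesis using F_soc c by simp
  qed
  then have "radW \<subseteq> socW"
    unfolding radW_def by (intro vec.span_minimal[OF _ subspace_socW]) blast
  \<comment> \<open>So dim W = card C0 + card R is at most 4, while dim B is at least 5.\<close>
  then have "card C0 \<le> card D"
    using vec.dim_subset C0(4) D(4) by metis
  moreover have "5 \<le> matsp.dim B"
    using matsp.independent_card_le_dim[OF eF_B ind] card_eF two by simp
  ultimately show False using card_sum two neg by simp
qed

end

section \<open>Reduction to primitive idempotents\<close>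

text \<open>A nonzero idempotent that is not primitive splits into orthogonal nonzero idempotents f
  and g. The images add up exactly and the corners inject as a direct sum, so the bounds for f and g
  add to the bound for \<open>e\<close>.\<close>

lemma idempotent_bound:
  fixes A :: "('k::alg_closed_field ^ 'n ^ 'n) set"
  assumes maximal: "maximal_commutative_matrix_subalgebra A"
  shows "e \<in> A \<Longrightarrow> e ** e = e \<Longrightarrow> vec.dim (fixed_space e) \<le> 6 \<Longrightarrow>
    vec.dim (fixed_space e) \<le> matsp.dim (corner A e)"
proof (induction "vec.dim (fixed_space e)" arbitrary: e rule: less_induct)
  case less
  note eA = less.prems(1) and ee = less.prems(2)
  interpret commutative_matrices A
    using maximal unfolding maximal_commutative_matrix_subalgebra_def
    by unfold_locales (rule conjunct1)
  have sub_corner: "matsp.subspace (corner A f)" for f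
    by (rule matsp.subspaceI)
       (auto simp: corner_def matrix_add_ldistrib matrix_scale_mult_right add_mem scale_mem zero_mem)
  consider "e = 0" | f where "f \<in> A" "f ** f = f" "e ** f = f" "f \<noteq> 0" "f \<noteq> e"
    | "e \<noteq> 0" "\<And>f. f \<in> A \<Longrightarrow> f ** f = f \<Longrightarrow> e ** f = f \<Longrightarrow> f = 0 \<or> f = e"
    by blast
  then show ?case
  proof cases
    case 1
    then have "fixed_space e = {0}" by (auto simp: fixed_space_def)
    then show ?thesis by simp
  next
    case 3
    interpret primitive_corner A e
      using eA ee 3 by unfold_locales auto
    have "A = matrix_centralizer A"
      using maximal unfolding maximal_commutative_matrix_subalgebra_def by (rule conjunct2)
    then show ?thesis
      by (rule corner_bound[OF equalityD2 less.prems(3)])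
  next
    case (2 f)
    define g where "g = e - f"
    have fe: "f ** e = f" using 2 commute[OF eA] by simp
    have g: "g \<in> A" "g ** g = g" "e ** g = g" "f ** g = 0" "g ** f = 0" "g \<noteq> 0"
      using 2 eA ee fe by (simp_all add: g_def diff_mem matrix_diff_ldistrib matrix_diff_rdistrib)
    have sum: "e = f + g" by (simp add: g_def)
    have dims: "vec.dim (fixed_space e) = vec.dim (fixed_space f) + vec.dim (fixed_space g)"
    proof -
      have "fixed_space f \<inter> fixed_space g = {0}"
      proof -
        have "v = 0" if "f *v v = v" "g *v v = v" for v
          using that g(4) by (metis matrix_vector_mul_assoc matrix_vector_mult_0)
        then show ?thesis by (auto simp: fixed_space_def)
      qed
      moreover have "{x + y |x y. x \<in> fixed_space f \<and> y \<in> fixed_space g} = fixed_space e"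
      proof (intro equalityI subsetI)
        fix v assume "v \<in> fixed_space e"
        then have "v = f *v v + g *v v"
          by (simp add: sum fixed_space_def matrix_vector_mult_add_rdistrib)
        moreover have "f *v v \<in> fixed_space f" "g *v v \<in> fixed_space g"
          using 2 g by (simp_all add: fixed_space_def matrix_vector_mul_assoc)
        ultimately show "v \<in> {x + y |x y. x \<in> fixed_space f \<and> y \<in> fixed_space g}" by blast
      next
        fix v assume "v \<in> {x + y |x y. x \<in> fixed_space f \<and> y \<in> fixed_space g}"
        then obtain x y where xy: "v = x + y" "f *v x = x" "g *v y = y"
          by (auto simp: fixed_space_def)
        have "e *v x = x" "e *v y = y"
          using xy 2(3) g(3) by (metis matrix_vector_mul_assoc)+
        then show "v \<in> fixed_space e"
          by (simp add: xy(1) fixed_space_def matrix_vector_right_distrib)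
      qed
      ultimately show ?thesis
        using vec.dim_sums_Int[OF subspace_fixed_space subspace_fixed_space, of f g] by simp
    qed
    \<comment> \<open>Both summands have positive rank, so each is strictly smaller than
      \<open>e\<close> and the induction hypothesis applies.\<close>
    have pos: "vec.dim (fixed_space h) > 0" if nz: "h \<noteq> 0" and idem: "h ** h = h" for h :: "'k ^ 'n ^ 'n"
    proof -
      obtain v where "h *v v \<noteq> 0" using nz matrix_eq[of h 0] by auto
      moreover have "h *v v \<in> fixed_space h"
        using idem by (simp add: fixed_space_def matrix_vector_mul_assoc)
      ultimately have "\<not> fixed_space h \<subseteq> {0}" by blast
      then show ?thesis by (metis gr0I vec.dim_eq_0)
    qed
    have "matsp.dim (corner A f \<inter> corner A g) = 0"
    proof -
      have "x = 0" if "f ** x = x" "g ** x = x" for x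
        using that g(4) by (metis matrix_mul_assoc times0_left)
      then have "corner A f \<inter> corner A g \<subseteq> {0}" by (auto simp: corner_def)
      then show ?thesis by simp
    qed
    moreover have "matsp.dim {x + y |x y. x \<in> corner A f \<and> y \<in> corner A g} \<le> matsp.dim (corner A e)"
    proof (rule matsp.dim_subset, clarify)
      fix x y assume xy: "x \<in> corner A f" "y \<in> corner A g"
      then have "e ** x = x" "e ** y = y"
        using 2(3) g(3) unfolding corner_def by (metis (mono_tags, lifting) matrix_mul_assoc mem_Collect_eq)+
      then show "x + y \<in> corner A e"
        using xy by (simp add: corner_def matrix_add_ldistrib add_mem)
    qed
    ultimately have "matsp.dim (corner A f) + matsp.dim (corner A g) \<le> matsp.dim (corner A e)"
      using matsp.dim_sums_Int[OF sub_corner sub_corner, of f g] by linarith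
    moreover have "vec.dim (fixed_space f) \<le> matsp.dim (corner A f)"
      by (rule less.hyps[OF _ 2(1,2)]) (use dims pos[OF g(6,2)] less.prems(3) in linarith)+
    moreover have "vec.dim (fixed_space g) \<le> matsp.dim (corner A g)"
      by (rule less.hyps[OF _ g(1,2)]) (use dims pos[OF 2(4,2)] less.prems(3) in linarith)+
    ultimately show ?thesis using dims by linarith
  qed
qed

theorem theorem1:
  fixes A :: "('k::alg_closed_field ^ 6 ^ 6) set"
  assumes "maximal_commutative_matrix_subalgebra A"
  shows "matsp.dim A \<ge> 6"
proof -
  have "commutative_matrix_subalgebra A"
    using assms unfolding maximal_commutative_matrix_subalgebra_def by (rule conjunct1)
  then have "mat 1 \<in> A"
    by (simp add: commutative_matrix_subalgebra_def matrix_subalgebra_def)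
  moreover have "fixed_space (mat 1 :: 'k ^ 6 ^ 6) = UNIV" "corner A (mat 1) = A"
    by (simp_all add: fixed_space_def corner_def)
  moreover have "vec.dim (UNIV :: ('k ^ 6) set) = 6"
    by (simp add: vec_dim_card del: vec.dim_UNIV)
  ultimately show ?thesis
    using idempotent_bound[OF assms, of "mat 1"] by simp
qed

end
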